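(* For the family of all finite abelian groups, $M(\alpha) \le m(\alpha)$ for every $\alpha \in [0,1]$, where $M$ is the threshold density for corners of this family and $m$ is the infimum function defined in the context.
   Context: Corners and $S_d$: for a finite abelian group $G$ with $|G| = N$, a subset $A \subset G\times G$ and $d \in G$, let $S_d = \{(x,y) \in G\times G : (x,y),\,(x+d,y),\,(x,y+d) \in A\}$. The density of $A$ is $|A|/N^2$. Threshold density: for a family of finite abelian groups and $\alpha\in[0,1]$, $M(\alpha)$ is the largest $M \in [0,1]$ such that for every $\epsilon > 0$ there is an $N_0$ such that for all groups $G$ in the family with $|G| = N \ge N_0$ and all subsets $A \subset G\times G$ of density at least $\alpha$, there is a $d \in G\setminus\{0\}$ with $|S_d| > (M-\epsilon)N^2$. Piecewise constant functions: $f:[0,1]^3\to[0,1]$ is piecewise constant if there are a positive integer $r$ and real numbers $0=x_0\le x_1\le\dots\le x_r=1$, $0=y_0\le\dots\le y_r=1$, $0=z_0\le\dots\le z_r=1$ such that $f$ is constant on $[x_i,x_{i+1})\times[y_j,y_{j+1})\times[z_k,z_{k+1})$ for all $0\le i,j,k\le r-1$. For such $f$ define $$T(f) = \int_0^1\int_0^1\int_0^1 \left(\int_0^1 f(x,y,z')\,dz'\right)\left(\int_0^1 f(x,y',z)\,dy'\right)\left(\int_0^1 f(x',y,z)\,dx'\right)dx\,dy\,dz,$$ and for $\alpha\in[0,1]$ define $m(\alpha) = \inf_f T(f)$, the infimum over all piecewise constant $f:[0,1]^3\to[0,1]$ with $\int_0^1\int_0^1\int_0^1 f(x,y,z)\,dx\,dy\,dz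 = \alpha$. *)

theory Defs
  imports "HOL-Analysis.Analysis" "HOL-Algebra.Algebra"
begin

definition corner_base_points :: "('a, 'b) monoid_scheme \<Rightarrow> ('a \<times> 'a) set \<Rightarrow> 'a \<Rightarrow> ('a \<times> 'a) set"
  where "corner_base_points G A d =
    {(x, y) \<in> carrier G \<times> carrier G.
       (x, y) \<in> A \<and> (x \<otimes>\<^bsub>G\<^esub> d, y) \<in> A \<and> (x, y \<otimes>\<^bsub>G\<^esub> d) \<in> A}"

definition pair_density :: "('a, 'b) monoid_scheme \<Rightarrow> ('a \<times> 'a) set \<Rightarrow> real"
  where "pair_density G A = real (card A) / (real (order G))\<^sup>2"

definition popular_corners :: "'a monoid set \<Rightarrow> real \<Rightarrow> real \<Rightarrow> bool"
  where "popular_corners \<G> \<alpha> M \<longleftrightarrow>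
    (\<forall>\<epsilon>>0. \<exists>N0::nat. \<forall>G\<in>\<G>. order G \<ge> N0 \<longrightarrow>
      (\<forall>A. A \<subseteq> carrier G \<times> carrier G \<and> pair_density G A \<ge> \<alpha> \<longrightarrow>
        (\<exists>d\<in>carrier G - {\<one>\<^bsub>G\<^esub>}.
           real (card (corner_base_points G A d)) > (M - \<epsilon>) * (real (order G))\<^sup>2)))"

definition threshold_density :: "'a monoid set \<Rightarrow> real \<Rightarrow> real"
  where "threshold_density \<G> \<alpha> = (GREATEST M. M \<in> {0..1} \<and> popular_corners \<G> \<alpha> M)"

text \<open>Every finite abelian group is isomorphic to one whose elements are natural numbers
  (see \<open>finite_comm_group_iso_nat\<close> below), so the carriers may be taken in \<^typ>\<open>nat\<close>.\<close>

definition finite_abelian_groups :: "nat monoid set"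
  where "finite_abelian_groups = {G. comm_group G \<and> finite (carrier G)}"

text \<open>Values of \<open>f\<close> outside the unit cube are irrelevant.  As the cells are half-open, the values
  on the faces where some coordinate equals 1 are unrestricted (apart from their range); they do
  not affect the iterated integrals below.\<close>

definition piecewise_constant :: "(real \<times> real \<times> real \<Rightarrow> real) \<Rightarrow> bool"
  where "piecewise_constant f \<longleftrightarrow>
    f \<in> {0..1} \<times> {0..1} \<times> {0..1} \<rightarrow> {0..1} \<and>
    (\<exists>(r::nat) (xs::nat \<Rightarrow> real) ys zs. r > 0 \<and>
       (\<forall>p\<in>{xs, ys, zs}. p 0 = 0 \<and> p r = 1 \<and> (\<forall>i<r. p i \<le> p (Suc i))) \<and>
       (\<forall>i<r. \<forall>j<r. \<forall>k<r.
          f constant_on ({xs i..<xs (Suc i)} \<times> {ys j..<ys (Suc j)} \<times> {zs k..<zs (Suc k)})))"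

definition cube_integral :: "(real \<times> real \<times> real \<Rightarrow> real) \<Rightarrow> real"
  where "cube_integral f =
    integral {0..1} (\<lambda>x. integral {0..1} (\<lambda>y. integral {0..1} (\<lambda>z. f (x, y, z))))"

definition corner_functional :: "(real \<times> real \<times> real \<Rightarrow> real) \<Rightarrow> real"
  where "corner_functional f = cube_integral (\<lambda>(x, y, z).
    integral {0..1} (\<lambda>z'. f (x, y, z')) *
    integral {0..1} (\<lambda>y'. f (x, y', z)) *
    integral {0..1} (\<lambda>x'. f (x', y, z)))"

definition corner_infimum :: "real \<Rightarrow> real"
  where "corner_infimum \<alpha> = Inf {corner_functional f | f. piecewise_constant f \<and> cube_integral f = \<alpha>}"

lemma finite_comm_group_iso_nat:
  fixes G :: "'a monoid"
  assumes "comm_group G" "finite (carrier G)"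
  shows "\<exists>H\<in>finite_abelian_groups. G \<cong> H"
proof -
  interpret comm_group G by fact
  obtain h :: "'a \<Rightarrow> nat" where h: "inj_on h (carrier G)"
    using finite_imp_inj_to_nat_seg[OF assms(2)] by blast
  let ?H = "image_group h G"
  have iso: "h \<in> iso G ?H"
    using h by (rule inj_imp_image_group_iso)
  have "comm_group ?H"
    using iso inj_imp_image_group_is_group[OF h] iso_imp_comm_group group.is_monoid
    by (auto simp: is_iso_def)
  moreover have "finite (carrier ?H)"
    using assms(2) by (simp add: image_group_def)
  ultimately show ?thesis
    using iso by (auto simp: finite_abelian_groups_def is_iso_def)
qed

text \<open>The maximum defining the threshold density is attained, so \<^const>\<open>Greatest\<close> is meaningful.\<close>

lemma threshold_density_greatest:
  fixes \<G> :: "'a monoid set"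
  shows "threshold_density \<G> \<alpha> \<in> {0..1}"
    and "popular_corners \<G> \<alpha> (threshold_density \<G> \<alpha>)"
    and "\<And>M. M \<in> {0..1} \<Longrightarrow> popular_corners \<G> \<alpha> M \<Longrightarrow> M \<le> threshold_density \<G> \<alpha>"
proof -
  define S where "S = {M. M \<in> {0..1} \<and> popular_corners \<G> \<alpha> M}"
  have "popular_corners \<G> \<alpha> 0"
    unfolding popular_corners_def
  proof (intro allI impI exI[of _ 2] ballI)
    fix \<epsilon> :: real and G A
    assume \<epsilon>: "\<epsilon> > 0" and G: "G \<in> \<G>" "2 \<le> order G"
    have "carrier G - {\<one>\<^bsub>G\<^esub>} \<noteq> {}"
    proof
      assume "carrier G - {\<one>\<^bsub>G\<^esub>} = {}"
      then have "carrier G \<subseteq> {\<one>\<^bsub>G\<^esub>}" by blast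
      then have "card (carrier G) \<le> 1" using card_mono[of "{\<one>\<^bsub>G\<^esub>}"] by simp
      with G show False by (simp add: order_def)
    qed
    then obtain d where "d \<in> carrier G - {\<one>\<^bsub>G\<^esub>}" by blast
    moreover have "(0 - \<epsilon>) * (real (order G))\<^sup>2 < 0"
      using \<epsilon> G by (simp add: mult_less_0_iff)
    ultimately show "\<exists>d\<in>carrier G - {\<one>\<^bsub>G\<^esub>}.
        (0 - \<epsilon>) * (real (order G))\<^sup>2 < real (card (corner_base_points G A d))"
      by (intro bexI[of _ d] order_less_le_trans[OF _ of_nat_0_le_iff])
  qed
  then have "0 \<in> S" by (simp add: S_def)
  then have ne: "S \<noteq> {}" by blast
  have bdd: "bdd_above S" by (auto simp: S_def intro: bdd_aboveI[of _ 1])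
  have up: "M \<le> Sup S" if "M \<in> S" for M using that bdd by (rule cSup_upper)
  have range: "Sup S \<in> {0..1}"
  proof -
    obtain M where M: "M \<in> S" using ne by blast
    then have "0 \<le> Sup S" using up[OF M] by (auto simp: S_def)
    moreover have "Sup S \<le> 1" using ne by (rule cSup_least) (auto simp: S_def)
    ultimately show ?thesis by simp
  qed
  have pop: "popular_corners \<G> \<alpha> (Sup S)"
    unfolding popular_corners_def
  proof (intro allI impI)
    fix \<epsilon> :: real assume \<epsilon>: "\<epsilon> > 0"
    then obtain M where M: "M \<in> S" "Sup S - \<epsilon> / 2 < M"
      using less_cSup_iff[OF ne bdd, of "Sup S - \<epsilon> / 2"] by auto
    have "popular_corners \<G> \<alpha> M" using M(1) by (simp add: S_def)
    moreover have "\<epsilon> / 2 > 0" using \<epsilon> by simp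
    ultimately obtain N0 where N0: "\<forall>G\<in>\<G>. order G \<ge> N0 \<longrightarrow>
      (\<forall>A. A \<subseteq> carrier G \<times> carrier G \<and> pair_density G A \<ge> \<alpha> \<longrightarrow>
        (\<exists>d\<in>carrier G - {\<one>\<^bsub>G\<^esub>}.
           real (card (corner_base_points G A d)) > (M - \<epsilon> / 2) * (real (order G))\<^sup>2))"
      unfolding popular_corners_def by blast
    have "(Sup S - \<epsilon>) * n\<^sup>2 \<le> (M - \<epsilon> / 2) * n\<^sup>2" for n :: real
      using M(2) by (intro mult_right_mono) auto
    with N0 show "\<exists>N0::nat. \<forall>G\<in>\<G>. order G \<ge> N0 \<longrightarrow>
      (\<forall>A. A \<subseteq> carrier G \<times> carrier G \<and> pair_density G A \<ge> \<alpha> \<longrightarrow>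
        (\<exists>d\<in>carrier G - {\<one>\<^bsub>G\<^esub>}.
           real (card (corner_base_points G A d)) > (Sup S - \<epsilon>) * (real (order G))\<^sup>2))"
      by (meson order_le_less_trans)
  qed
  have "threshold_density \<G> \<alpha> = Sup S"
    unfolding threshold_density_def
    by (rule Greatest_equality) (use range pop up in \<open>auto simp: S_def\<close>)
  then show "threshold_density \<G> \<alpha> \<in> {0..1}" "popular_corners \<G> \<alpha> (threshold_density \<G> \<alpha>)"
    "\<And>M. M \<in> {0..1} \<Longrightarrow> popular_corners \<G> \<alpha> M \<Longrightarrow> M \<le> threshold_density \<G> \<alpha>"
    using range pop up by (auto simp: S_def)
qed

end

theory Submission
  imports Defs "HOL-Probability.Hoeffding" "HOL-Real_Asymp.Real_Asymp"
begin

text \<open>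
  For a piecewise constant \<open>f\<close> and arbitrarily large groups \<open>G\<close>, a random construction gives a set
  \<open>A\<close> of density at least \<open>\<alpha> = \<integral> f\<close> in which every nonzero difference \<open>d\<close> has at most about
  \<open>T(f) N\<^sup>2\<close> corners. So no threshold above \<open>T(f)\<close> is popular, and the infimum over \<open>f\<close> follows.

  The construction labels every row \<open>x\<close>, every column \<open>y\<close> and every antidiagonal \<open>x + y = z\<close> of
  \<open>G \<times> G\<close> independently with the index of a grid interval, an interval being chosen with probability
  equal to its length, and puts \<open>(x, y)\<close> into \<open>A\<close> with probability the value of \<open>f\<close> on the cell
  given by the three labels. The expected density is \<open>\<integral> f\<close>. The three points
  \<open>(x, y)\<close>, \<open>(x + d, y)\<close>, \<open>(x, y + d)\<close> of a corner lie on two rows, two columns and the two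
  antidiagonals \<open>x + y\<close> and \<open>x + y + d\<close>, and each pair of points shares exactly one of these lines.
  With \<open>x, y, z\<close> for the shared labels and primes for the others, the
  probability of the corner is the integral of \<open>f(x, y, z') f(x, y', z) f(x', y, z)\<close>, which is
  \<open>T(f)\<close>; this needs \<open>d \<noteq> 0\<close>, so that the two rows, columns and antidiagonals are distinct
  (\<open>prob_point\<close>, \<open>prob_corner\<close>).

  All \<open>N\<close> values of \<open>d\<close> have to be controlled at once. A variance bound leaves a failure probability
  of order \<open>1/N\<close> for each of them, too weak for a union bound, so an exponential tail is
  required (\<open>count_concentration\<close>). The events at different points are dependent
  only if the points nearly share a line, which happens for at most \<open>9 N\<close> partners of a given point;
  greedily, there is a set \<open>L\<close> of at least \<open>N/9\<close> points with independent events. Conflicts are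
  translation invariant, so every translate of \<open>L\<close> is as good, and the translates cover
  \<open>G \<times> G\<close> uniformly: if the count over \<open>G \<times> G\<close> deviates from its mean, so does the count over
  some translate. Hoeffding's inequality on each of the \<open>N\<^sup>2\<close> translates makes the total failure
  probability \<open>O(N\<^sup>3 exp(-c N))\<close>. Finally, a set of density slightly below \<open>\<alpha>\<close> is topped up by
  few points, each of which creates at most three new corners for each \<open>d\<close>.
\<close>

section \<open>Integrals of step functions\<close>

lemma step_function_has_integral:
  fixes p :: "nat \<Rightarrow> real" and g :: "real \<Rightarrow> real"
  assumes mono: "\<And>i. i < n \<Longrightarrow> p i \<le> p (Suc i)"
    and step: "\<And>i x. i < n \<Longrightarrow> x \<in> {p i..<p (Suc i)} \<Longrightarrow> g x = c i"
  shows "p 0 \<le> p n \<and> (g has_integral (\<Sum>i<n. (p (Suc i) - p i) * c i)) {p 0..p n}"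
  using assms
proof (induction n)
  case 0
  then show ?case by (simp add: has_integral_refl)
next
  case (Suc n)
  have IH: "p 0 \<le> p n" "(g has_integral (\<Sum>i<n. (p (Suc i) - p i) * c i)) {p 0..p n}"
    using Suc.IH Suc.prems by auto
  have le: "p n \<le> p (Suc n)" using Suc.prems(1) by simp
  have "((\<lambda>x. c n) has_integral (p (Suc n) - p n) * c n) {p n..p (Suc n)}"
    using has_integral_const_real[of "c n" "p n" "p (Suc n)"] le by simp
  then have "(g has_integral (p (Suc n) - p n) * c n) {p n..p (Suc n)}"
    by (rule has_integral_spike_finite[rotated 2, where S = "{p (Suc n)}"])
      (use Suc.prems(2)[of n] in auto)
  with IH le have "(g has_integral ((\<Sum>i<n. (p (Suc i) - p i) * c i) + (p (Suc n) - p n) * c n)) {p 0..p (Suc n)}"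
    by (intro has_integral_combine[of "p 0" "p n"]) auto
  then show ?case using IH le by simp
qed

lemma unit_step_integral:
  fixes p :: "nat \<Rightarrow> real" and g :: "real \<Rightarrow> real"
  assumes "p 0 = 0" "p r = 1" "\<And>i. i < r \<Longrightarrow> p i \<le> p (Suc i)"
    and "\<And>i x. i < r \<Longrightarrow> x \<in> {p i..<p (Suc i)} \<Longrightarrow> g x = c i"
  shows "integral {0..1} g = (\<Sum>i<r. (p (Suc i) - p i) * c i)"
  using step_function_has_integral[of r p g c] assms by (auto intro: integral_unique)

text \<open>
  Agreement with \<open>H\<close> on the half-open cells suffices, as each of the three nested integrals is
  insensitive to its endpoint 1.
\<close>

lemma cube_integral_step:
  fixes xs ys zs :: "nat \<Rightarrow> real"
  assumes grid: "\<And>p. p \<in> {xs, ys, zs} \<Longrightarrow> p 0 = 0 \<and> p r = 1 \<and> (\<forall>i<r. p i \<le> p (Suc i))"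
    and step: "\<And>i j k x y z. \<lbrakk>i < r; j < r; k < r; x \<in> {xs i..<xs (Suc i)};
      y \<in> {ys j..<ys (Suc j)}; z \<in> {zs k..<zs (Suc k)}\<rbrakk> \<Longrightarrow> h (x, y, z) = H i j k"
  shows "cube_integral h = (\<Sum>i<r. \<Sum>j<r. \<Sum>k<r.
    (xs (Suc i) - xs i) * (ys (Suc j) - ys j) * (zs (Suc k) - zs k) * H i j k)"
proof -
  have z: "integral {0..1} (\<lambda>z. h (x, y, z)) = (\<Sum>k<r. (zs (Suc k) - zs k) * H i j k)"
    if "i < r" "j < r" "x \<in> {xs i..<xs (Suc i)}" "y \<in> {ys j..<ys (Suc j)}" for i j x y
    by (rule unit_step_integral) (use grid[of zs] step that in auto)
  have y: "integral {0..1} (\<lambda>y. integral {0..1} (\<lambda>z. h (x, y, z))) =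
      (\<Sum>j<r. (ys (Suc j) - ys j) * (\<Sum>k<r. (zs (Suc k) - zs k) * H i j k))"
    if "i < r" "x \<in> {xs i..<xs (Suc i)}" for i x
    by (rule unit_step_integral) (use grid[of ys] z that in auto)
  have "cube_integral h = (\<Sum>i<r. (xs (Suc i) - xs i) *
      (\<Sum>j<r. (ys (Suc j) - ys j) * (\<Sum>k<r. (zs (Suc k) - zs k) * H i j k)))"
    unfolding cube_integral_def
    by (rule unit_step_integral) (use grid[of xs] y in auto)
  then show ?thesis by (simp add: sum_distrib_left mult.assoc)
qed

lemma grid_points_in_unit_interval:
  fixes p :: "nat \<Rightarrow> real"
  assumes "p 0 = 0" "p r = 1" "\<And>i. i < r \<Longrightarrow> p i \<le> p (Suc i)" "i < r"
  shows "p i \<in> {0..1}"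
proof -
  have "p 0 \<le> p i"
    using step_function_has_integral[of i p "\<lambda>_. 0" "\<lambda>_. 0"] assms by auto
  moreover have "p i \<le> p r"
    using assms(3,4) by (intro inc_induct[of i r "\<lambda>m. p m \<le> p r"]) (auto intro: order_trans)
  ultimately show ?thesis using assms by simp
qed

lemma grid_lengths_pmf:
  fixes p :: "nat \<Rightarrow> real"
  assumes "p 0 = 0" "p r = 1" "\<And>i. i < r \<Longrightarrow> p i \<le> p (Suc i)"
  obtains w :: "nat pmf" where "\<And>i. i < r \<Longrightarrow> pmf w i = p (Suc i) - p i"
proof -
  define a where "a = (\<lambda>i. if i < r then p (Suc i) - p i else 0)"
  have nn: "0 \<le> a i" for i using assms by (simp add: a_def)
  have "(\<integral>\<^sup>+ i. ennreal (a i) \<partial>count_space UNIV) = (\<integral>\<^sup>+ i. ennreal (a i) \<partial>count_space {..<r})"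
    by (rule nn_integral_count_space_eq) (auto simp: a_def)
  also have "\<dots> = (\<Sum>i<r. ennreal (a i))" by (rule nn_integral_count_space_finite) simp
  also have "\<dots> = ennreal (\<Sum>i<r. a i)" using nn by (simp add: sum_ennreal)
  also have "(\<Sum>i<r. a i) = (\<Sum>i<r. p (Suc i) - p i)" by (simp add: a_def)
  also have "\<dots> = 1" using assms sum_lessThan_telescope[of p r] by simp
  finally have "pmf (embed_pmf a) i = a i" for i using nn by (intro pmf_embed_pmf) auto
  then show ?thesis by (intro that[of "embed_pmf a"]) (simp add: a_def)
qed

section \<open>Concentration of counts of weakly dependent events on a group\<close>

text \<open>
  A maximal independent set of a graph dominates it, so the neighbourhoods of its members, of at
  most \<open>K\<close> points each, cover \<open>V\<close>.
\<close>

lemma independent_set_lower_bound: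
  assumes fin: "finite V" and refl: "\<And>v. v \<in> V \<Longrightarrow> R v v" and sym: "\<And>v w. R v w \<Longrightarrow> R w v"
    and deg: "\<And>v. v \<in> V \<Longrightarrow> card {w \<in> V. R v w} \<le> K"
  obtains L where "L \<subseteq> V" "\<And>v w. v \<in> L \<Longrightarrow> w \<in> L \<Longrightarrow> v \<noteq> w \<Longrightarrow> \<not> R v w" "card V \<le> K * card L"
proof -
  define F where "F = {L \<in> Pow V. \<forall>v\<in>L. \<forall>w\<in>L. v \<noteq> w \<longrightarrow> \<not> R v w}"
  have "finite F" "F \<noteq> {}" using fin by (auto simp: F_def)
  then obtain L where "L \<in> F" and max: "\<And>L'. L' \<in> F \<Longrightarrow> L \<subseteq> L' \<Longrightarrow> L = L'"
    using finite_has_maximal[of F] by blast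
  then have L: "L \<subseteq> V" "\<And>v w. v \<in> L \<Longrightarrow> w \<in> L \<Longrightarrow> v \<noteq> w \<Longrightarrow> \<not> R v w"
    by (auto simp: F_def)
  have "V \<subseteq> (\<Union>v\<in>L. {w \<in> V. R v w})"
  proof
    fix w assume w: "w \<in> V"
    show "w \<in> (\<Union>v\<in>L. {w \<in> V. R v w})"
    proof (rule ccontr)
      assume *: "w \<notin> (\<Union>v\<in>L. {w \<in> V. R v w})"
      then have "w \<notin> L" using refl w by blast
      moreover have "insert w L \<in> F" using * L w sym by (auto simp: F_def)
      then have "L = insert w L" using max[of "insert w L"] by blast
      ultimately show False by blast
    qed
  qed
  moreover have finL: "finite L" using L(1) fin finite_subset by blast
  ultimately have "card V \<le> card (\<Union>v\<in>L. {w \<in> V. R v w})"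
    using fin by (intro card_mono) auto
  also have "\<dots> \<le> (\<Sum>v\<in>L. card {w \<in> V. R v w})" using finL by (rule card_UN_le)
  also have "\<dots> \<le> (\<Sum>v\<in>L. K)" using L(1) deg by (intro sum_mono) auto
  finally have "card V \<le> K * card L" by (simp add: mult.commute)
  with L show ?thesis by (intro that[of L]) auto
qed

context comm_group
begin

definition differ_by :: "'a \<Rightarrow> 'a \<Rightarrow> 'a \<Rightarrow> bool"
  where "differ_by d x x' \<longleftrightarrow> x = x' \<or> x' = x \<otimes> d \<or> x = x' \<otimes> d"

text \<open>
  The events at \<open>q\<close> and \<open>q'\<close> can depend on a common label only if the lines of some type through
  the two corners of difference \<open>d\<close> overlap. For rows, the corner at \<open>(x, y)\<close> uses \<open>x\<close> and
  \<open>x \<otimes> d\<close>, and likewise for columns and antidiagonals.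
\<close>

definition share_line :: "'a \<Rightarrow> 'a \<times> 'a \<Rightarrow> 'a \<times> 'a \<Rightarrow> bool"
  where "share_line d q q' \<longleftrightarrow> differ_by d (fst q) (fst q') \<or> differ_by d (snd q) (snd q') \<or>
    differ_by d (fst q \<otimes> snd q) (fst q' \<otimes> snd q')"

definition translate :: "'a \<times> 'a \<Rightarrow> 'a \<times> 'a \<Rightarrow> 'a \<times> 'a"
  where "translate t q = (fst q \<otimes> fst t, snd q \<otimes> snd t)"

lemma differ_by_translate:
  assumes "d \<in> carrier G" "x \<in> carrier G" "x' \<in> carrier G" "t \<in> carrier G"
  shows "differ_by d (x \<otimes> t) (x' \<otimes> t) \<longleftrightarrow> differ_by d x x'"
proof -
  have "u \<otimes> t \<otimes> d = u \<otimes> d \<otimes> t" if "u \<in> carrier G" for u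
    using assms that by (simp add: m_ac)
  then show ?thesis using assms by (simp add: differ_by_def)
qed

lemma share_line_translate:
  assumes "d \<in> carrier G" "q \<in> carrier G \<times> carrier G" "q' \<in> carrier G \<times> carrier G"
    "t \<in> carrier G \<times> carrier G"
  shows "share_line d (translate t q) (translate t q') \<longleftrightarrow> share_line d q q'"
proof -
  have "(x \<otimes> a) \<otimes> (y \<otimes> b) = (x \<otimes> y) \<otimes> (a \<otimes> b)"
    if "x \<in> carrier G" "y \<in> carrier G" "a \<in> carrier G" "b \<in> carrier G" for x y a b
    using that by (simp add: m_ac)
  then show ?thesis using assms
    by (auto simp: share_line_def translate_def differ_by_translate)
qed

lemma card_differ_by:
  assumes "d \<in> carrier G" "x \<in> carrier G"
  shows "finite {x' \<in> carrier G. differ_by d x x'}" "card {x' \<in> carrier G. differ_by d x x'} \<le> 3"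
proof -
  have sub: "{x' \<in> carrier G. differ_by d x x'} \<subseteq> {x, x \<otimes> d, x \<otimes> inv d}"
    using assms by (auto simp: differ_by_def m_assoc)
  then show "finite {x' \<in> carrier G. differ_by d x x'}" by (rule finite_subset) simp
  have "card {x' \<in> carrier G. differ_by d x x'} \<le> card {x, x \<otimes> d, x \<otimes> inv d}"
    using sub by (intro card_mono) auto
  also have "\<dots> \<le> 3" by (auto simp: card_insert_if)
  finally show "card {x' \<in> carrier G. differ_by d x x'} \<le> 3" .
qed

text \<open>
  For each of the three types of lines, one coordinate of \<open>q'\<close> has at most three values and another one
  is free. Antidiagonals reduce to this by parametrising \<open>q'\<close> by its row and its antidiagonal.
\<close>

lemma card_share_line:
  assumes fin: "finite (carrier G)" and d: "d \<in> carrier G" and q: "q \<in> carrier G \<times> carrier G"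
  shows "card {q' \<in> carrier G \<times> carrier G. share_line d q q'} \<le> 9 * order G"
proof -
  obtain x y where [simp]: "q = (x, y)" and xy: "x \<in> carrier G" "y \<in> carrier G" using q by auto
  define N where "N u = {u' \<in> carrier G. differ_by d u u'}" for u
  have N: "finite (N u)" "card (N u) \<le> 3" if "u \<in> carrier G" for u
    using card_differ_by[OF d that] by (auto simp: N_def)
  let ?C = "carrier G" and ?g = "\<lambda>(a, s). (a, inv a \<otimes> s)"
  have "{q' \<in> ?C \<times> ?C. share_line d q q'} \<subseteq> N x \<times> ?C \<union> ?C \<times> N y \<union> ?g ` (?C \<times> N (x \<otimes> y))"
  proof
    fix q' assume q': "q' \<in> {q' \<in> ?C \<times> ?C. share_line d q q'}"
    obtain a b where [simp]: "q' = (a, b)" by fastforce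
    have "q' = ?g (a, a \<otimes> b)" using q' by (simp add: m_assoc[symmetric])
    moreover have "(a, a \<otimes> b) \<in> ?C \<times> N (x \<otimes> y)" if "differ_by d (x \<otimes> y) (a \<otimes> b)"
      using q' that by (auto simp: N_def)
    ultimately have "q' \<in> ?g ` (?C \<times> N (x \<otimes> y))" if "differ_by d (x \<otimes> y) (a \<otimes> b)"
      using that by (intro image_eqI[where x = "(a, a \<otimes> b)"]) blast+
    then show "q' \<in> N x \<times> ?C \<union> ?C \<times> N y \<union> ?g ` (?C \<times> N (x \<otimes> y))"
      using q' by (auto simp: share_line_def N_def)
  qed
  then have "card {q' \<in> ?C \<times> ?C. share_line d q q'} \<le>
      card (N x \<times> ?C \<union> ?C \<times> N y \<union> ?g ` (?C \<times> N (x \<otimes> y)))"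
    using fin N xy by (intro card_mono) auto
  also have "\<dots> \<le> card (N x \<times> ?C) + card (?C \<times> N y) + card (?g ` (?C \<times> N (x \<otimes> y)))"
    by (meson add_le_mono1 card_Un_le order_trans)
  also have "\<dots> \<le> card (N x \<times> ?C) + card (?C \<times> N y) + card (?C \<times> N (x \<otimes> y))"
    using fin N xy by (intro add_left_mono card_image_le) auto
  also have "\<dots> \<le> 3 * card ?C + card ?C * 3 + card ?C * 3"
    unfolding card_cartesian_product using N xy by (intro add_mono mult_mono) auto
  finally show ?thesis by (simp add: order_def)
qed

lemma spread_out_set:
  assumes fin: "finite (carrier G)" and d: "d \<in> carrier G"
  obtains L where "L \<subseteq> carrier G \<times> carrier G" "order G \<le> 9 * card L"
    "\<And>q q'. q \<in> L \<Longrightarrow> q' \<in> L \<Longrightarrow> q \<noteq> q' \<Longrightarrow> \<not> share_line d q q'"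
proof -
  obtain L where L: "L \<subseteq> carrier G \<times> carrier G"
      "\<And>q q'. q \<in> L \<Longrightarrow> q' \<in> L \<Longrightarrow> q \<noteq> q' \<Longrightarrow> \<not> share_line d q q'"
      "card (carrier G \<times> carrier G) \<le> 9 * order G * card L"
  proof (rule independent_set_lower_bound[of "carrier G \<times> carrier G" "share_line d" "9 * order G"])
    show "share_line d v w \<Longrightarrow> share_line d w v" for v w
      by (auto simp: share_line_def differ_by_def)
  qed (use fin card_share_line[OF fin d] in \<open>auto simp: share_line_def differ_by_def\<close>)
  have "order G * order G \<le> order G * (9 * card L)"
    using L(3) by (simp add: card_cartesian_product order_def mult_ac)
  moreover have "order G > 0" using fin by (simp add: order_gt_0_iff_finite)
  ultimately have "order G \<le> 9 * card L" by simp
  with L show ?thesis by (intro that)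
qed

lemma bij_translate:
  assumes "q \<in> carrier G \<times> carrier G"
  shows "bij_betw (\<lambda>t. translate t q) (carrier G \<times> carrier G) (carrier G \<times> carrier G)"
proof -
  have cancel: "inv a \<otimes> (a \<otimes> u) = u" "a \<otimes> (inv a \<otimes> u) = u"
    if "a \<in> carrier G" "u \<in> carrier G" for a u
    using that by (simp_all add: m_assoc[symmetric])
  show ?thesis
    by (rule bij_betw_byWitness[where f' = "\<lambda>s. (inv (fst q) \<otimes> fst s, inv (snd q) \<otimes> snd s)"])
      (use assms in \<open>auto simp: translate_def cancel\<close>)
qed

text \<open>
  Every point of \<open>G \<times> G\<close> is hit equally often by the translates of \<open>L\<close>, so the deviation of
  \<open>S\<close> over \<open>G \<times> G\<close> is the average of its deviations over the translates.
\<close>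

lemma deviation_of_some_translate:
  assumes fin: "finite (carrier G)" and S: "S \<subseteq> carrier G \<times> carrier G"
    and L: "L \<subseteq> carrier G \<times> carrier G"  "L \<noteq> {}"
    and dev: "\<bar>real (card S) - \<mu> * (real (order G))\<^sup>2\<bar> \<ge> \<epsilon> * (real (order G))\<^sup>2"
  shows "\<exists>t\<in>carrier G \<times> carrier G.
    \<bar>(\<Sum>q\<in>L. indicator S (translate t q)) - \<mu> * real (card L)\<bar> \<ge> \<epsilon> * real (card L)"
proof (rule ccontr)
  let ?C = "carrier G \<times> carrier G"
  assume neg: "\<not> ?thesis"
  have finC: "finite ?C" using fin by simp
  have finL: "finite L" using L finC finite_subset by blast
  then have L0: "real (card L) > 0" using L by (simp add: card_gt_0_iff)
  have N: "real (card ?C) = (real (order G))\<^sup>2"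
    by (simp add: card_cartesian_product order_def power2_eq_square)
  have "(\<Sum>t\<in>?C. \<Sum>q\<in>L. indicator S (translate t q)) = (\<Sum>q\<in>L. \<Sum>t\<in>?C. indicator S (translate t q) :: real)"
    by (rule sum.swap)
  also have "\<dots> = (\<Sum>q\<in>L. \<Sum>s\<in>?C. indicator S s)"
    using L by (intro sum.cong refl sum.reindex_bij_betw bij_translate) auto
  also have "(\<Sum>s\<in>?C. indicator S s) = real (card S)"
    using S finC sum.inter_restrict[of ?C "\<lambda>_. 1 :: real" S]
    by (simp add: indicator_def Int_absorb1)
  finally have eq: "(\<Sum>t\<in>?C. (\<Sum>q\<in>L. indicator S (translate t q)) - \<mu> * real (card L)) =
      real (card L) * (real (card S) - \<mu> * (real (order G))\<^sup>2)"
    by (simp add: sum_subtractf N del: card_cartesian_product) (simp add: algebra_simps)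
  have "real (card L) * \<bar>real (card S) - \<mu> * (real (order G))\<^sup>2\<bar> =
      \<bar>\<Sum>t\<in>?C. (\<Sum>q\<in>L. indicator S (translate t q)) - \<mu> * real (card L)\<bar>"
    unfolding eq by (simp add: abs_mult)
  also have "\<dots> \<le> (\<Sum>t\<in>?C. \<bar>(\<Sum>q\<in>L. indicator S (translate t q)) - \<mu> * real (card L)\<bar>)"
    by (rule sum_abs)
  also have "\<dots> < (\<Sum>t\<in>?C. \<epsilon> * real (card L))"
    using neg finC by (intro sum_strict_mono) (auto simp: not_le)
  also have "\<dots> = real (card L) * (\<epsilon> * (real (order G))\<^sup>2)"
    by (simp add: N[symmetric] del: card_cartesian_product)
  finally have "\<bar>real (card S) - \<mu> * (real (order G))\<^sup>2\<bar> < \<epsilon> * (real (order G))\<^sup>2"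
    using L0 by simp
  then show False using dev by simp
qed


text \<open>
  The event \<open>E q\<close> is determined by the coordinates in \<open>B q\<close>, and two such blocks overlap only for
  points that share a line. Along a translate of a spread-out set the events are therefore
  independent; Hoeffding's inequality and a union bound over the translates finish the argument.
\<close>

lemma count_concentration:
  fixes p :: "'i \<Rightarrow> nat pmf" and E :: "'a \<times> 'a \<Rightarrow> ('i \<Rightarrow> nat) set"
  assumes fin: "finite (carrier G)" and d: "d \<in> carrier G" and I: "finite I"
    and block: "\<And>q. q \<in> carrier G \<times> carrier G \<Longrightarrow> B q \<subseteq> I"
    and local: "\<And>q \<omega> \<omega>'. q \<in> carrier G \<times> carrier G \<Longrightarrow> (\<And>s. s \<in> B q \<Longrightarrow> \<omega> s = \<omega>' s) \<Longrightarrow>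
      \<omega> \<in> E q \<longleftrightarrow> \<omega>' \<in> E q"
    and prob: "\<And>q. q \<in> carrier G \<times> carrier G \<Longrightarrow> measure_pmf.prob (Pi_pmf I 0 p) (E q) = \<mu>"
    and meet: "\<And>q q'. q \<in> carrier G \<times> carrier G \<Longrightarrow> q' \<in> carrier G \<times> carrier G \<Longrightarrow>
      B q \<inter> B q' \<noteq> {} \<Longrightarrow> share_line d q q'"
    and \<epsilon>: "\<epsilon> > 0"
  shows "measure_pmf.prob (Pi_pmf I 0 p)
      {\<omega>. \<bar>real (card {q \<in> carrier G \<times> carrier G. \<omega> \<in> E q}) - \<mu> * (real (order G))\<^sup>2\<bar> \<ge> \<epsilon> * (real (order G))\<^sup>2}
    \<le> (real (order G))\<^sup>2 * (2 * exp (- (2 * \<epsilon>\<^sup>2 / 9) * real (order G)))"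
proof -
  let ?C = "carrier G \<times> carrier G" and ?P = "Pi_pmf I 0 p"
  obtain L where L: "L \<subseteq> ?C" "order G \<le> 9 * card L"
    and apart: "\<And>q q'. q \<in> L \<Longrightarrow> q' \<in> L \<Longrightarrow> q \<noteq> q' \<Longrightarrow> \<not> share_line d q q'"
    using spread_out_set[OF fin d] by metis
  have finC: "finite ?C" using fin by simp
  have finL: "finite L" using L(1) finC finite_subset by blast
  have N0: "order G > 0" using fin by (simp add: order_gt_0_iff_finite)
  then have cL: "card L > 0" using L(2) by linarith
  have tr: "translate t q \<in> ?C" if "t \<in> ?C" "q \<in> ?C" for t q
    using that by (auto simp: translate_def)
  define bad where "bad t = {\<omega>. \<bar>(\<Sum>q\<in>L. indicator (E (translate t q)) \<omega>) - \<mu> * real (card L)\<bar>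
    \<ge> \<epsilon> * real (card L)}" for t
  have tail: "measure_pmf.prob ?P (bad t) \<le> 2 * exp (- (2 * \<epsilon>\<^sup>2 / 9) * real (order G))"
    if t: "t \<in> ?C" for t
  proof -
    define Z where "Z q = (\<lambda>\<omega>. indicator (E (translate t q)) \<omega> :: real)" for q
    define B' where "B' q = B (translate t q)" for q
    have B': "B' q \<subseteq> I" if "q \<in> L" for q unfolding B'_def
      by (intro block tr[OF t]) (use that L(1) in blast)
    have disj: "disjoint_family_on B' L"
      unfolding disjoint_family_on_def B'_def
    proof (intro ballI impI)
      fix q q' assume q: "q \<in> L" "q' \<in> L" "q \<noteq> q'"
      then have "\<not> share_line d (translate t q) (translate t q')"
        using apart[OF q] L(1) t by (subst share_line_translate[OF d]) auto
      then show "B (translate t q) \<inter> B (translate t q') = {}"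
        using meet[of "translate t q" "translate t q'"] tr[OF t] q L(1) by blast
    qed
    have "prob_space.indep_vars (measure_pmf ?P) (\<lambda>q. PiM (B' q) (\<lambda>_. count_space UNIV))
        (\<lambda>q \<omega>. restrict (\<lambda>s. \<omega> s) (B' q)) L"
      by (rule prob_space.indep_vars_restrict[OF measure_pmf.prob_space_axioms
        indep_vars_Pi_pmf[OF I] B' disj])
    then have "prob_space.indep_vars (measure_pmf ?P) (\<lambda>_. borel) (\<lambda>q \<omega>. Z q (restrict (\<lambda>s. \<omega> s) (B' q))) L"
    proof (rule prob_space.indep_vars_compose2[OF measure_pmf.prob_space_axioms])
      fix q assume "q \<in> L"
      then have "finite (B' q)" using B' I finite_subset by blast
      then show "Z q \<in> borel_measurable (PiM (B' q) (\<lambda>_. count_space UNIV))"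
        by (subst count_space_PiM_finite) auto
    qed
    moreover have "Z q (restrict (\<lambda>s. \<omega> s) (B' q)) = Z q \<omega>" if "q \<in> L" for q \<omega>
      using local[OF tr[OF t], of q "restrict (\<lambda>s. \<omega> s) (B' q)" \<omega>] that L(1)
      by (auto simp: Z_def B'_def indicator_def)
    ultimately have indep: "prob_space.indep_vars (measure_pmf ?P) (\<lambda>_. borel) Z L"
      by (subst prob_space.indep_vars_cong[OF measure_pmf.prob_space_axioms refl _ refl]) auto
    have "measure_pmf.expectation ?P (Z q) = \<mu>" if "q \<in> L" for q
      using prob[OF tr[OF t]] that L(1) by (auto simp: Z_def)
    then have mean: "(\<Sum>q\<in>L. measure_pmf.expectation ?P (Z q)) = \<mu> * real (card L)" by simp
    interpret Hoeffding_ineq "measure_pmf ?P" L Z "\<lambda>_. 0" "\<lambda>_. 1" "\<mu> * real (card L)"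
    proof unfold_locales
      show "finite L" by (rule finL)
      show "prob_space.indep_vars (measure_pmf ?P) (\<lambda>_. borel) Z L" by (rule indep)
    qed (simp_all add: mean, simp add: Z_def)
    have "measure_pmf.prob ?P (bad t) \<le> 2 * exp (- 2 * (\<epsilon> * real (card L))\<^sup>2 / real (card L))"
      using Hoeffding_ineq_abs_ge[of "\<epsilon> * real (card L)"] \<epsilon> cL by (simp add: bad_def Z_def)
    also have "- 2 * (\<epsilon> * real (card L))\<^sup>2 / real (card L) = - (2 * \<epsilon>\<^sup>2 / 9) * real (9 * card L)"
      using cL by (simp add: power2_eq_square)
    also have "\<dots> \<le> - (2 * \<epsilon>\<^sup>2 / 9) * real (order G)"
      using L(2) by (intro mult_left_mono_neg) auto
    finally show ?thesis by simp
  qed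
  have "{\<omega>. \<bar>real (card {q \<in> ?C. \<omega> \<in> E q}) - \<mu> * (real (order G))\<^sup>2\<bar> \<ge> \<epsilon> * (real (order G))\<^sup>2}
      \<subseteq> (\<Union>t\<in>?C. bad t)"
  proof safe
    fix \<omega> assume dev: "\<bar>real (card {q \<in> ?C. \<omega> \<in> E q}) - \<mu> * (real (order G))\<^sup>2\<bar> \<ge> \<epsilon> * (real (order G))\<^sup>2"
    have "\<exists>t\<in>?C. \<bar>(\<Sum>q\<in>L. indicator {q \<in> ?C. \<omega> \<in> E q} (translate t q)) - \<mu> * real (card L)\<bar>
        \<ge> \<epsilon> * real (card L)"
      using cL by (intro deviation_of_some_translate fin L(1) dev) auto
    then obtain t where t: "t \<in> ?C" and
      "\<bar>(\<Sum>q\<in>L. indicator {q \<in> ?C. \<omega> \<in> E q} (translate t q)) - \<mu> * real (card L)\<bar> \<ge> \<epsilon> * real (card L)"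
      by blast
    moreover have "(\<Sum>q\<in>L. indicator {q \<in> ?C. \<omega> \<in> E q} (translate t q)) =
        (\<Sum>q\<in>L. indicator (E (translate t q)) \<omega> :: real)"
      using tr[OF t] L(1) by (intro sum.cong) (auto simp: indicator_def)
    ultimately show "\<omega> \<in> (\<Union>t\<in>?C. bad t)" by (auto simp: bad_def)
  qed
  then have "measure_pmf.prob ?P {\<omega>. \<bar>real (card {q \<in> ?C. \<omega> \<in> E q}) - \<mu> * (real (order G))\<^sup>2\<bar> \<ge> \<epsilon> * (real (order G))\<^sup>2}
      \<le> measure_pmf.prob ?P (\<Union>t\<in>?C. bad t)"
    by (intro measure_pmf.finite_measure_mono) auto
  also have "\<dots> \<le> (\<Sum>t\<in>?C. measure_pmf.prob ?P (bad t))"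
    using finC by (intro measure_pmf.finite_measure_subadditive_finite) auto
  also have "\<dots> \<le> (\<Sum>t\<in>?C. 2 * exp (- (2 * \<epsilon>\<^sup>2 / 9) * real (order G)))"
    by (intro sum_mono tail)
  also have "\<dots> = (real (order G))\<^sup>2 * (2 * exp (- (2 * \<epsilon>\<^sup>2 / 9) * real (order G)))"
    by (simp add: card_cartesian_product order_def power2_eq_square)
  finally show ?thesis .
qed

end

section \<open>The random set attached to a step function\<close>

text \<open>
  Below, \<open>step_mean\<close> and \<open>step_corner\<close> are \<open>\<integral> f\<close> and \<open>T(f)\<close> for the function \<open>f\<close> with value \<open>F (i, j, k)\<close> on the cell
  \<open>(i, j, k)\<close>, when \<open>pmf a i\<close>, \<open>pmf b j\<close> and \<open>pmf c k\<close> are the side lengths of that cell.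
\<close>

definition step_mean :: "nat pmf \<Rightarrow> nat pmf \<Rightarrow> nat pmf \<Rightarrow> nat \<Rightarrow> (nat \<times> nat \<times> nat \<Rightarrow> real) \<Rightarrow> real"
  where "step_mean a b c r F =
    (\<Sum>i<r. \<Sum>j<r. \<Sum>k<r. pmf a i * pmf b j * pmf c k * F (i, j, k))"

definition step_corner :: "nat pmf \<Rightarrow> nat pmf \<Rightarrow> nat pmf \<Rightarrow> nat \<Rightarrow> (nat \<times> nat \<times> nat \<Rightarrow> real) \<Rightarrow> real"
  where "step_corner a b c r F =
    (\<Sum>i<r. \<Sum>j<r. \<Sum>k<r. pmf a i * pmf b j * pmf c k *
      ((\<Sum>k'<r. pmf c k' * F (i, j, k')) * (\<Sum>j'<r. pmf b j' * F (i, j', k)) *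
       (\<Sum>i'<r. pmf a i' * F (i', j, k))))"

text \<open>
  The independent random coordinates. Every point carries one biased coin for each cell, of
  which only the coin of the actual cell is consulted: independent coordinates with fixed laws
  then replace a single coin whose bias would depend on the labels.
\<close>

datatype 'a site = Row 'a | Col 'a | Diag 'a | Coin "'a \<times> 'a" "nat \<times> nat \<times> nat"

primrec site_pmf :: "nat pmf \<Rightarrow> nat pmf \<Rightarrow> nat pmf \<Rightarrow> (nat \<times> nat \<times> nat \<Rightarrow> real) \<Rightarrow> 'a site \<Rightarrow> nat pmf"
  where "site_pmf a b c F (Row x) = a"
  | "site_pmf a b c F (Col x) = b"
  | "site_pmf a b c F (Diag x) = c"
  | "site_pmf a b c F (Coin q t) = map_pmf of_bool (bernoulli_pmf (F t))"

lemma prob_pinned_sites: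
  assumes I: "finite I" and ps: "distinct (map fst ps)" "fst ` set ps \<subseteq> I"
  shows "measure_pmf.prob (Pi_pmf I dflt p) {\<omega>. \<forall>(s, v)\<in>set ps. \<omega> s = v} =
    (\<Prod>(s, v)\<leftarrow>ps. pmf (p s) v)"
proof -
  define B where "B s = (case map_of ps s of None \<Rightarrow> UNIV | Some v \<Rightarrow> {v})" for s
  have B1: "B s = {v}" if "(s, v) \<in> set ps" for s v
    using that ps(1) by (simp add: B_def)
  have B2: "B s = UNIV" if "s \<notin> fst ` set ps" for s
    using that by (simp add: B_def map_of_eq_None_iff[symmetric] del: map_of_eq_None_iff)
  have "{\<omega>. \<forall>(s, v)\<in>set ps. \<omega> s = v} = Pi I B"
  proof (intro Set.set_eqI iffI)
    fix \<omega> assume *: "\<omega> \<in> {\<omega>. \<forall>(s, v)\<in>set ps. \<omega> s = v}"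
    have "\<omega> s \<in> B s" for s
    proof (cases "s \<in> fst ` set ps")
      case True
      then obtain v where "(s, v) \<in> set ps" by auto
      then show ?thesis using * B1 by auto
    qed (simp add: B2)
    then show "\<omega> \<in> Pi I B" by simp
  qed (use B1 ps(2) in \<open>fastforce simp: Pi_def\<close>)
  then have "measure_pmf.prob (Pi_pmf I dflt p) {\<omega>. \<forall>(s, v)\<in>set ps. \<omega> s = v} =
      (\<Prod>s\<in>I. measure_pmf.prob (p s) (B s))"
    using I by (simp add: measure_Pi_pmf_Pi)
  also have "\<dots> = (\<Prod>s\<in>fst ` set ps. measure_pmf.prob (p s) (B s))"
    using I ps(2) by (intro prod.mono_neutral_right) (auto simp: B2)
  also have "\<dots> = (\<Prod>s\<in>set (map fst ps). measure_pmf.prob (p s) (B s))" by simp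
  also have "\<dots> = (\<Prod>s\<leftarrow>map fst ps. measure_pmf.prob (p s) (B s))"
    using ps(1) by (rule prod.distinct_set_conv_list)
  also have "\<dots> = (\<Prod>(s, v)\<leftarrow>ps. pmf (p s) v)"
    unfolding map_map by (intro arg_cong[of _ _ prod_list] map_cong) (auto simp: B1 measure_pmf_single)
  finally show ?thesis .
qed

text \<open>
  An event decided by finitely many coordinates is a disjoint union of boxes; here it is presented by the
  finite list of values that each box prescribes.
\<close>

lemma prob_disjoint_pinned_sites:
  assumes I: "finite I" and T: "finite T"
    and ps: "\<And>t. t \<in> T \<Longrightarrow> distinct (map fst (ps t)) \<and> fst ` set (ps t) \<subseteq> I"
    and disj: "\<And>t t' \<omega>. t \<in> T \<Longrightarrow> t' \<in> T \<Longrightarrow> \<forall>(s, v)\<in>set (ps t). \<omega> s = v \<Longrightarrow>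
      \<forall>(s, v)\<in>set (ps t'). \<omega> s = v \<Longrightarrow> t = t'"
  shows "measure_pmf.prob (Pi_pmf I dflt p) {\<omega>. \<exists>t\<in>T. \<forall>(s, v)\<in>set (ps t). \<omega> s = v} =
    (\<Sum>t\<in>T. \<Prod>(s, v)\<leftarrow>ps t. pmf (p s) v)"
proof -
  define A where "A t = {\<omega>. \<forall>(s, v)\<in>set (ps t). \<omega> s = v}" for t
  have "A t \<inter> A t' = {}" if "t \<in> T" "t' \<in> T" "t \<noteq> t'" for t t'
    using disj[OF that(1,2)] that(3) unfolding A_def by blast
  then have "measure_pmf.prob (Pi_pmf I dflt p) (\<Union>t\<in>T. A t) =
      (\<Sum>t\<in>T. measure_pmf.prob (Pi_pmf I dflt p) (A t))"
    using T by (intro measure_pmf.finite_measure_finite_Union) (auto simp: disjoint_family_on_def)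
  also have "(\<Union>t\<in>T. A t) = {\<omega>. \<exists>t\<in>T. \<forall>(s, v)\<in>set (ps t). \<omega> s = v}"
    by (auto simp: A_def)
  also have "(\<Sum>t\<in>T. measure_pmf.prob (Pi_pmf I dflt p) (A t)) =
      (\<Sum>t\<in>T. \<Prod>(s, v)\<leftarrow>ps t. pmf (p s) v)"
    unfolding A_def using ps I by (intro sum.cong refl prob_pinned_sites) auto
  finally show ?thesis .
qed

locale corner_model = comm_group G for G (structure) +
  fixes a b c :: "nat pmf" and r :: nat and F :: "nat \<times> nat \<times> nat \<Rightarrow> real"
  assumes finite_carrier: "finite (carrier G)"
    and F_range: "\<And>i j k. i < r \<Longrightarrow> j < r \<Longrightarrow> k < r \<Longrightarrow> F (i, j, k) \<in> {0..1}"
begin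

definition cells :: "(nat \<times> nat \<times> nat) set"
  where "cells = {..<r} \<times> {..<r} \<times> {..<r}"

definition sites :: "'a site set"
  where "sites = Row ` carrier G \<union> Col ` carrier G \<union> Diag ` carrier G \<union>
    (\<lambda>(q, t). Coin q t) ` ((carrier G \<times> carrier G) \<times> cells)"

abbreviation model :: "('a site \<Rightarrow> nat) pmf"
  where "model \<equiv> Pi_pmf sites 0 (site_pmf a b c F)"

definition cell_of :: "('a site \<Rightarrow> nat) \<Rightarrow> 'a \<times> 'a \<Rightarrow> nat \<times> nat \<times> nat"
  where "cell_of \<omega> q = (\<omega> (Row (fst q)), \<omega> (Col (snd q)), \<omega> (Diag (fst q \<otimes> snd q)))"

text \<open>
  A label outside the grid excludes the point, so that membership only consults the
  finitely many coordinates in \<open>sites\<close>.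
\<close>

definition random_set :: "('a site \<Rightarrow> nat) \<Rightarrow> ('a \<times> 'a) set"
  where "random_set \<omega> = {q \<in> carrier G \<times> carrier G. cell_of \<omega> q \<in> cells \<and> \<omega> (Coin q (cell_of \<omega> q)) = 1}"

definition corner :: "'a \<Rightarrow> 'a \<times> 'a \<Rightarrow> ('a \<times> 'a) set"
  where "corner d q = {q, (fst q \<otimes> d, snd q), (fst q, snd q \<otimes> d)}"

text \<open>
  For \<open>d = \<one>\<close> the corner degenerates to the point \<open>q\<close>, and the event says that \<open>q\<close> lies in the
  random set. The density of the set and its corner counts are thus instances of one count.
\<close>

definition corner_event :: "'a \<Rightarrow> 'a \<times> 'a \<Rightarrow> ('a site \<Rightarrow> nat) set"
  where "corner_event d q = {\<omega>. corner d q \<subseteq> random_set \<omega>}"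

definition point_block :: "'a \<times> 'a \<Rightarrow> 'a site set"
  where "point_block q = {Row (fst q), Col (snd q), Diag (fst q \<otimes> snd q)} \<union> Coin q ` cells"

definition corner_block :: "'a \<Rightarrow> 'a \<times> 'a \<Rightarrow> 'a site set"
  where "corner_block d q = \<Union> (point_block ` corner d q)"

lemma finite_sites: "finite sites"
  using finite_carrier by (simp add: sites_def cells_def)

lemma corner_subset:
  "d \<in> carrier G \<Longrightarrow> q \<in> carrier G \<times> carrier G \<Longrightarrow> corner d q \<subseteq> carrier G \<times> carrier G"
  by (auto simp: corner_def)

lemma corner_block_subset:
  assumes "d \<in> carrier G" "q \<in> carrier G \<times> carrier G"
  shows "corner_block d q \<subseteq> sites"
proof -
  have "point_block q' \<subseteq> sites" if "q' \<in> carrier G \<times> carrier G" for q'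
    using that by (auto simp: point_block_def sites_def)
  then show ?thesis using corner_subset[OF assms] by (auto simp: corner_block_def)
qed

lemma corner_event_local:
  assumes "\<And>s. s \<in> corner_block d q \<Longrightarrow> \<omega> s = \<omega>' s"
  shows "\<omega> \<in> corner_event d q \<longleftrightarrow> \<omega>' \<in> corner_event d q"
proof -
  have "q' \<in> random_set \<omega> \<longleftrightarrow> q' \<in> random_set \<omega>'" if "q' \<in> corner d q" for q'
  proof -
    have eq: "\<omega> s = \<omega>' s" if "s \<in> point_block q'" for s
      using assms that \<open>q' \<in> corner d q\<close> by (auto simp: corner_block_def)
    then have "cell_of \<omega> q' = cell_of \<omega>' q'" by (simp add: cell_of_def point_block_def)
    then show ?thesis using eq by (auto simp: random_set_def point_block_def)
  qed
  then show ?thesis by (auto simp: corner_event_def)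
qed

lemma corner_blocks_meet:
  assumes d: "d \<in> carrier G" and q: "q \<in> carrier G \<times> carrier G" and q': "q' \<in> carrier G \<times> carrier G"
    and meet: "corner_block d q \<inter> corner_block d q' \<noteq> {}"
  shows "share_line d q q'"
proof -
  have near: "differ_by d u v" if "u \<in> carrier G" "v \<in> carrier G" "{u, u \<otimes> d} \<inter> {v, v \<otimes> d} \<noteq> {}" for u v
    using that d by (auto simp: differ_by_def)
  have sums: "fst s \<otimes> snd s \<in> {fst p \<otimes> snd p, fst p \<otimes> snd p \<otimes> d}"
    if "p \<in> carrier G \<times> carrier G" "s \<in> corner d p" for p s
    using that d by (auto simp: corner_def m_ac)
  have coords: "fst s \<in> {fst p, fst p \<otimes> d}" "snd s \<in> {snd p, snd p \<otimes> d}" if "s \<in> corner d p" for p s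
    using that by (auto simp: corner_def)
  obtain s p p' where s: "p \<in> corner d q" "p' \<in> corner d q'" "s \<in> point_block p" "s \<in> point_block p'"
    using meet by (auto simp: corner_block_def)
  then consider "fst p = fst p'" | "snd p = snd p'" | "fst p \<otimes> snd p = fst p' \<otimes> snd p'"
    by (auto simp: point_block_def)
  then show ?thesis
  proof cases
    case 1
    then have "{fst q, fst q \<otimes> d} \<inter> {fst q', fst q' \<otimes> d} \<noteq> {}"
      using coords(1)[OF s(1)] coords(1)[OF s(2)] by auto
    then show ?thesis using near q q' by (auto simp: share_line_def)
  next
    case 2
    then have "{snd q, snd q \<otimes> d} \<inter> {snd q', snd q' \<otimes> d} \<noteq> {}"
      using coords(2)[OF s(1)] coords(2)[OF s(2)] by auto
    then show ?thesis using near q q' by (auto simp: share_line_def)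
  next
    case 3
    then have "{fst q \<otimes> snd q, fst q \<otimes> snd q \<otimes> d} \<inter> {fst q' \<otimes> snd q', fst q' \<otimes> snd q' \<otimes> d} \<noteq> {}"
      using sums[OF q s(1)] sums[OF q' s(2)] by auto
    moreover have "fst q \<otimes> snd q \<in> carrier G" "fst q' \<otimes> snd q' \<in> carrier G" using q q' by auto
    ultimately have "differ_by d (fst q \<otimes> snd q) (fst q' \<otimes> snd q')" using near by blast
    then show ?thesis by (simp add: share_line_def)
  qed
qed

lemma coin_prob:
  assumes "(i, j, k) \<in> cells"
  shows "pmf (site_pmf a b c F (Coin q (i, j, k))) 1 = F (i, j, k)"
proof -
  have "pmf (map_pmf of_bool (bernoulli_pmf (F (i, j, k)))) (of_bool True :: nat) = F (i, j, k)"
    using F_range[of i j k] assms by (subst pmf_map_inj') (auto simp: cells_def inj_def)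
  then show ?thesis by simp
qed

lemma sum_cells: "(\<Sum>(i, j, k)\<in>cells. g i j k) = (\<Sum>i<r. \<Sum>j<r. \<Sum>k<r. (g i j k :: real))"
  by (simp add: cells_def sum.cartesian_product[symmetric])

lemma prob_point:
  assumes q: "q \<in> carrier G \<times> carrier G"
  shows "measure_pmf.prob model (corner_event \<one> q) = step_mean a b c r F"
proof -
  obtain x y where [simp]: "q = (x, y)" and xy: "x \<in> carrier G" "y \<in> carrier G" using q by auto
  define pins where "pins = (\<lambda>(i, j, k). [(Row x, i), (Col y, j), (Diag (x \<otimes> y), k),
    (Coin (x, y) (i, j, k), 1 :: nat)])"
  have "corner_event \<one> q = {\<omega>. \<exists>t\<in>cells. \<forall>(s, v)\<in>set (pins t). \<omega> s = v}"
    using xy by (auto simp: corner_event_def corner_def random_set_def cell_of_def pins_def)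
  then have "measure_pmf.prob model (corner_event \<one> q) =
      (\<Sum>t\<in>cells. \<Prod>(s, v)\<leftarrow>pins t. pmf (site_pmf a b c F s) v)"
    using xy by (simp only:, intro prob_disjoint_pinned_sites finite_sites)
      (auto simp: pins_def sites_def cells_def)
  also have "\<dots> = (\<Sum>(i, j, k)\<in>cells. pmf a i * pmf b j * pmf c k * F (i, j, k))"
  proof (intro sum.cong refl)
    fix t assume "t \<in> cells"
    moreover obtain i j k where "t = (i, j, k)" by (cases t)
    ultimately show "(\<Prod>(s, v)\<leftarrow>pins t. pmf (site_pmf a b c F s) v) =
        (case t of (i, j, k) \<Rightarrow> pmf a i * pmf b j * pmf c k * F (i, j, k))"
      using coin_prob[of i j k "(x, y)"] by (simp add: pins_def del: site_pmf.simps(4))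
  qed
  finally show ?thesis by (simp add: sum_cells step_mean_def)
qed

text \<open>
  As \<open>d \<noteq> \<one>\<close>, the corner involves two distinct rows, columns and antidiagonals and three coins. The
  labels \<open>i, j, k\<close> belong to the row, column and antidiagonal that are shared by two of the three points,
  and \<open>i', j', k'\<close> to the other ones; summing over \<open>i', j', k'\<close> gives the product of
  the three inner sums.
\<close>

lemma prob_corner:
  assumes d: "d \<in> carrier G - {\<one>}" and q: "q \<in> carrier G \<times> carrier G"
  shows "measure_pmf.prob model (corner_event d q) = step_corner a b c r F"
proof -
  obtain x y where [simp]: "q = (x, y)" and xy: "x \<in> carrier G" "y \<in> carrier G" using q by auto
  have dG: "d \<in> carrier G" using d by simp
  have z: "x \<otimes> d \<otimes> y = x \<otimes> y \<otimes> d" "x \<otimes> (y \<otimes> d) = x \<otimes> y \<otimes> d"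
    using xy dG by (simp_all add: m_ac)
  have ne: "u \<otimes> d \<noteq> u" if "u \<in> carrier G" for u
    using d that by (metis DiffE insertI1 l_cancel_one)
  have ne': "x \<otimes> d \<noteq> x" "y \<otimes> d \<noteq> y" "x \<otimes> y \<otimes> d \<noteq> x \<otimes> y"
    using ne xy by auto
  define pins where "pins = (\<lambda>(i, j, k, k', j', i').
    [(Row x, i), (Row (x \<otimes> d), i'), (Col y, j), (Col (y \<otimes> d), j'),
     (Diag (x \<otimes> y \<otimes> d), k), (Diag (x \<otimes> y), k'), (Coin (x, y) (i, j, k'), 1),
     (Coin (x, y \<otimes> d) (i, j', k), 1), (Coin (x \<otimes> d, y) (i', j, k), 1 :: nat)])"
  define T where "T = {..<r} \<times> {..<r} \<times> {..<r} \<times> {..<r} \<times> {..<r} \<times> {..<r}"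
  \<comment> \<open>The only values that \<open>\<omega>\<close> can be pinned to; this makes the boxes disjoint.\<close>
  define labels where "labels \<omega> = (\<omega> (Row x), \<omega> (Col y), \<omega> (Diag (x \<otimes> y \<otimes> d)), \<omega> (Diag (x \<otimes> y)),
    \<omega> (Col (y \<otimes> d)), \<omega> (Row (x \<otimes> d)))" for \<omega> :: "'a site \<Rightarrow> nat"
  have pinned: "t = labels \<omega>" if "\<forall>(s, v)\<in>set (pins t). \<omega> s = v" for t \<omega>
    using that by (cases t) (simp add: pins_def labels_def)
  have event: "\<omega> \<in> corner_event d q \<longleftrightarrow>
      labels \<omega> \<in> T \<and> (\<forall>(s, v)\<in>set (pins (labels \<omega>)). \<omega> s = v)" for \<omega>
    using xy dG by (simp add: corner_event_def corner_def random_set_def cell_of_def pins_def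
      labels_def cells_def T_def z) blast
  have wf_pins: "distinct (map fst (pins t)) \<and> fst ` set (pins t) \<subseteq> sites" if t: "t \<in> T" for t
  proof -
    obtain i j k k' j' i' where [simp]: "t = (i, j, k, k', j', i')" by (cases t)
    have "distinct (map fst (pins t))" using ne' ne'[symmetric] by (simp add: pins_def)
    moreover have "fst ` set (pins t) \<subseteq> sites"
      using xy dG t by (simp add: pins_def sites_def cells_def T_def image_iff)
    ultimately show ?thesis by simp
  qed
  have "corner_event d q = {\<omega>. \<exists>t\<in>T. \<forall>(s, v)\<in>set (pins t). \<omega> s = v}"
  proof (intro Set.set_eqI iffI)
    fix \<omega> assume "\<omega> \<in> {\<omega>. \<exists>t\<in>T. \<forall>(s, v)\<in>set (pins t). \<omega> s = v}"
    then obtain t where t: "t \<in> T" "\<forall>(s, v)\<in>set (pins t). \<omega> s = v" by blast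
    then show "\<omega> \<in> corner_event d q" using event[of \<omega>] pinned[OF t(2)] by simp
  next
    fix \<omega> assume "\<omega> \<in> corner_event d q"
    then have "labels \<omega> \<in> T" "\<forall>(s, v)\<in>set (pins (labels \<omega>)). \<omega> s = v"
      using event[of \<omega>] by simp_all
    then show "\<omega> \<in> {\<omega>. \<exists>t\<in>T. \<forall>(s, v)\<in>set (pins t). \<omega> s = v}" by blast
  qed
  also have "measure_pmf.prob model \<dots> = (\<Sum>t\<in>T. \<Prod>(s, v)\<leftarrow>pins t. pmf (site_pmf a b c F s) v)"
  proof (rule prob_disjoint_pinned_sites[OF finite_sites _ wf_pins])
    show "finite T" by (simp add: T_def)
    show "t = t'" if "\<forall>(s, v)\<in>set (pins t). \<omega> s = v" "\<forall>(s, v)\<in>set (pins t'). \<omega> s = v" for t t' \<omega>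
      using pinned[OF that(1)] pinned[OF that(2)] by simp
  qed
  also have "\<dots> = (\<Sum>(i, j, k, k', j', i')\<in>T. pmf a i * pmf b j * pmf c k *
      ((pmf c k' * F (i, j, k')) * ((pmf b j' * F (i, j', k)) * (pmf a i' * F (i', j, k)))))"
  proof (intro sum.cong refl)
    fix t assume "t \<in> T"
    moreover obtain i j k k' j' i' where "t = (i, j, k, k', j', i')" by (cases t)
    ultimately show "(\<Prod>(s, v)\<leftarrow>pins t. pmf (site_pmf a b c F s) v) =
        (case t of (i, j, k, k', j', i') \<Rightarrow> pmf a i * pmf b j * pmf c k *
      ((pmf c k' * F (i, j, k')) * ((pmf b j' * F (i, j', k)) * (pmf a i' * F (i', j, k)))))"
      using coin_prob[of i j k' "(x, y)"] coin_prob[of i j' k "(x, y \<otimes> d)"]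
        coin_prob[of i' j k "(x \<otimes> d, y)"]
      by (simp add: pins_def T_def cells_def del: site_pmf.simps(4))
  qed
  also have "\<dots> = (\<Sum>i<r. \<Sum>j<r. \<Sum>k<r. \<Sum>k'<r. \<Sum>j'<r. \<Sum>i'<r. pmf a i * pmf b j * pmf c k *
      ((pmf c k' * F (i, j, k')) * ((pmf b j' * F (i, j', k)) * (pmf a i' * F (i', j, k)))))"
    by (simp add: T_def sum.cartesian_product[symmetric])
  also have "\<dots> = step_corner a b c r F"
  proof -
    have "(\<Sum>k'<r. \<Sum>j'<r. \<Sum>i'<r. w * (f k' * (g j' * h i'))) =
        w * ((\<Sum>k'<r. f k') * (\<Sum>j'<r. g j') * (\<Sum>i'<r. h i'))" for w :: real and f g h
      by (simp only: sum_distrib_left[symmetric] sum_distrib_right[symmetric] mult.assoc)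
    then show ?thesis by (simp only: step_corner_def)
  qed
  finally show ?thesis .
qed

text \<open>
  A union bound over all \<open>d\<close> in the group. The summand \<open>d = \<one>\<close> takes care of the cardinality of
  the set, which is why a factor \<open>N\<^sup>3\<close> suffices.
\<close>

lemma exists_set_with_typical_counts:
  assumes \<epsilon>: "\<epsilon> > 0"
    and large: "(real (order G))^3 * (2 * exp (- (2 * \<epsilon>\<^sup>2 / 9) * real (order G))) < 1"
  obtains A where "A \<subseteq> carrier G \<times> carrier G"
    "real (card A) > (step_mean a b c r F - \<epsilon>) * (real (order G))\<^sup>2"
    "\<And>d. d \<in> carrier G - {\<one>} \<Longrightarrow>
      real (card (corner_base_points G A d)) < (step_corner a b c r F + \<epsilon>) * (real (order G))\<^sup>2"
proof -
  define \<mu> where "\<mu> d = (if d = \<one> then step_mean a b c r F else step_corner a b c r F)" for d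
  define bad where "bad d = {\<omega>. \<bar>real (card {q \<in> carrier G \<times> carrier G. \<omega> \<in> corner_event d q}) -
    \<mu> d * (real (order G))\<^sup>2\<bar> \<ge> \<epsilon> * (real (order G))\<^sup>2}" for d
  have "measure_pmf.prob model (bad d) \<le>
      (real (order G))\<^sup>2 * (2 * exp (- (2 * \<epsilon>\<^sup>2 / 9) * real (order G)))" if d: "d \<in> carrier G" for d
    unfolding bad_def
  proof (rule count_concentration[OF finite_carrier d finite_sites _ _ _ _ \<epsilon>])
    show "measure_pmf.prob model (corner_event d q) = \<mu> d" if "q \<in> carrier G \<times> carrier G" for q
      using that d prob_point prob_corner by (auto simp: \<mu>_def)
    show "corner_block d q \<subseteq> sites" if "q \<in> carrier G \<times> carrier G" for q
      using d that by (rule corner_block_subset)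
    show "\<omega> \<in> corner_event d q \<longleftrightarrow> \<omega>' \<in> corner_event d q"
      if "\<And>s. s \<in> corner_block d q \<Longrightarrow> \<omega> s = \<omega>' s" for q \<omega> \<omega>'
      using that by (rule corner_event_local)
    show "share_line d q q'"
      if "q \<in> carrier G \<times> carrier G" "q' \<in> carrier G \<times> carrier G"
        "corner_block d q \<inter> corner_block d q' \<noteq> {}" for q q'
      using d that by (rule corner_blocks_meet)
  qed
  then have "(\<Sum>d\<in>carrier G. measure_pmf.prob model (bad d)) \<le>
      (\<Sum>d\<in>carrier G. (real (order G))\<^sup>2 * (2 * exp (- (2 * \<epsilon>\<^sup>2 / 9) * real (order G))))"
    by (rule sum_mono)
  also have "\<dots> < 1" using large by (simp add: order_def power3_eq_cube power2_eq_square mult.assoc)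
  finally have "measure_pmf.prob model (\<Union>d\<in>carrier G. bad d) < 1"
    using measure_pmf.finite_measure_subadditive_finite[OF finite_carrier, of bad model] by simp
  then have "(\<Union>d\<in>carrier G. bad d) \<noteq> UNIV" by (metis measure_pmf_UNIV less_irrefl)
  then obtain \<omega> where good: "\<And>d. d \<in> carrier G \<Longrightarrow> \<omega> \<notin> bad d" by blast
  show ?thesis
  proof (rule that[of "random_set \<omega>"])
    show sub: "random_set \<omega> \<subseteq> carrier G \<times> carrier G" by (auto simp: random_set_def)
    have "{q \<in> carrier G \<times> carrier G. \<omega> \<in> corner_event \<one> q} = random_set \<omega>"
      using sub by (auto simp: corner_event_def corner_def)
    then show "real (card (random_set \<omega>)) > (step_mean a b c r F - \<epsilon>) * (real (order G))\<^sup>2"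
      using good[of \<one>] by (simp add: bad_def \<mu>_def algebra_simps abs_le_iff not_le abs_less_iff)
    fix d assume d: "d \<in> carrier G - {\<one>}"
    have "{q \<in> carrier G \<times> carrier G. \<omega> \<in> corner_event d q} = corner_base_points G (random_set \<omega>) d"
      by (auto simp: corner_event_def corner_def corner_base_points_def)
    then show "real (card (corner_base_points G (random_set \<omega>) d)) <
        (step_corner a b c r F + \<epsilon>) * (real (order G))\<^sup>2"
      using good[of d] d by (simp add: bad_def \<mu>_def algebra_simps abs_le_iff not_le abs_less_iff)
  qed
qed

end

section \<open>The threshold density is at most the infimum\<close>

lemma finite_abelian_group_of_order:
  assumes "n > 0"
  obtains G where "G \<in> finite_abelian_groups" "order G = n"
proof -
  let ?Z = "integer_mod_group n"
  have "comm_group ?Z" by (rule abelian_integer_mod_group)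
  moreover have "finite (carrier ?Z)" using assms by (simp add: carrier_integer_mod_group)
  ultimately obtain H where H: "H \<in> finite_abelian_groups" "?Z \<cong> H"
    using finite_comm_group_iso_nat by blast
  then have "card (carrier ?Z) = card (carrier H)" by (intro iso_same_card)
  then have "order H = n" using assms by (simp add: order_def carrier_integer_mod_group)
  with H show ?thesis by (intro that)
qed

lemma enlarge_to_density:
  fixes G (structure) and A :: "('a \<times> 'a) set"
  assumes fin: "finite (carrier G)" and N: "order G > 0" and A: "A \<subseteq> carrier G \<times> carrier G"
    and dens: "real (card A) > (\<alpha> - \<epsilon>) * (real (order G))\<^sup>2" and \<alpha>: "\<alpha> \<le> 1" and \<epsilon>: "\<epsilon> \<ge> 0"
  obtains A' where "A \<subseteq> A'" "A' \<subseteq> carrier G \<times> carrier G" "pair_density G A' \<ge> \<alpha>"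
    "real (card (A' - A)) \<le> \<epsilon> * (real (order G))\<^sup>2 + 1"
proof -
  let ?C = "carrier G \<times> carrier G"
  define n where "n = max (card A) (nat \<lceil>\<alpha> * (real (order G))\<^sup>2\<rceil>)"
  have finC: "finite ?C" using fin by simp
  have C: "card ?C = (order G)\<^sup>2" by (simp add: card_cartesian_product order_def power2_eq_square)
  have "\<alpha> * (real (order G))\<^sup>2 \<le> real ((order G)\<^sup>2)"
    using \<alpha> by (simp add: mult_left_le_one_le mult_right_mono[of \<alpha> 1, simplified])
  then have "nat \<lceil>\<alpha> * (real (order G))\<^sup>2\<rceil> \<le> card ?C"
    unfolding C by (simp add: ceiling_le_iff nat_le_iff)
  then have "n \<le> card ?C" using A finC by (simp add: n_def card_mono del: card_cartesian_product)
  then obtain A' where A': "A \<subseteq> A'" "A' \<subseteq> ?C" "card A' = n"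
    using exists_subset_between[of A n ?C] A finC by (auto simp: n_def)
  have "\<alpha> * (real (order G))\<^sup>2 \<le> real n" by (simp add: n_def) linarith
  then have "pair_density G A' \<ge> \<alpha>"
    using N A'(3) by (simp add: pair_density_def pos_le_divide_eq)
  moreover have "finite A" "card (A' - A) = n - card A"
    using A' A finC finite_subset by (auto intro!: card_Diff_subset simp: A'(3)[symmetric])
  moreover have "real n \<le> real (card A) + (\<epsilon> * (real (order G))\<^sup>2 + 1)"
  proof -
    have "\<alpha> * (real (order G))\<^sup>2 < real (card A) + \<epsilon> * (real (order G))\<^sup>2"
      using dens by (simp add: algebra_simps)
    moreover have "0 \<le> real (card A) + \<epsilon> * (real (order G))\<^sup>2" using \<epsilon> by simp
    moreover have "0 \<le> \<epsilon> * (real (order G))\<^sup>2" using \<epsilon> by simp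
    ultimately show ?thesis unfolding n_def max_def by auto linarith+
  qed
  moreover have "card A \<le> n" by (simp add: n_def)
  ultimately show ?thesis using A' by (intro that[of A']) auto
qed

text \<open>
  A corner that is new in \<open>A'\<close> has one of its three points in \<open>A' - A\<close>, and for fixed \<open>d\<close> each of
  the three positions determines the corner.
\<close>

lemma (in group) card_corner_base_points_enlarge:
  assumes fin: "finite (carrier G)" and d: "d \<in> carrier G"
    and A: "A \<subseteq> A'" "A' \<subseteq> carrier G \<times> carrier G"
  shows "card (corner_base_points G A' d) \<le> card (corner_base_points G A d) + 3 * card (A' - A)"
proof -
  let ?C = "carrier G \<times> carrier G"
  define D1 where "D1 = {q \<in> ?C. (fst q \<otimes> d, snd q) \<in> A' - A}"
  define D2 where "D2 = {q \<in> ?C. (fst q, snd q \<otimes> d) \<in> A' - A}"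
  have finC: "finite ?C" using fin by simp
  moreover have "corner_base_points G A d \<subseteq> ?C" "D1 \<subseteq> ?C" "D2 \<subseteq> ?C"
    by (auto simp: corner_base_points_def D1_def D2_def)
  ultimately have fins: "finite A'" "finite (corner_base_points G A d)" "finite D1" "finite D2"
    using A(2) finite_subset by blast+
  have D1: "card D1 \<le> card (A' - A)"
    by (rule card_inj_on_le[where f = "\<lambda>q. (fst q \<otimes> d, snd q)"])
      (use d fins in \<open>auto simp: D1_def inj_on_def\<close>)
  have D2: "card D2 \<le> card (A' - A)"
    by (rule card_inj_on_le[where f = "\<lambda>q. (fst q, snd q \<otimes> d)"])
      (use d fins in \<open>auto simp: D2_def inj_on_def\<close>)
  have "corner_base_points G A' d \<subseteq> corner_base_points G A d \<union> ((A' - A) \<union> (D1 \<union> D2))"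
    by (auto simp: corner_base_points_def D1_def D2_def)
  then have "card (corner_base_points G A' d) \<le> card (corner_base_points G A d \<union> ((A' - A) \<union> (D1 \<union> D2)))"
    using fins by (intro card_mono) auto
  also have "\<dots> \<le> card (corner_base_points G A d) + (card (A' - A) + (card D1 + card D2))"
    by (meson card_Un_le add_left_mono order_trans)
  finally show ?thesis using D1 D2 by simp
qed

text \<open>
  If the threshold density \<open>M\<close> exceeded \<open>T\<close>, popularity would give more than
  \<open>(M - \<eta>) N\<^sup>2\<close> corners for some \<open>d\<close> in a set that has fewer than \<open>(T + 5 \<eta>) N\<^sup>2\<close> of them.
  Here one \<open>\<eta>\<close> comes from the random set, three from the topping up, and one absorbs the
  rounding error of at most three corners; hence the value \<open>\<eta> = (M - T) / 6\<close>.
\<close>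

lemma threshold_density_le_step_corner:
  assumes F: "\<And>i j k. i < r \<Longrightarrow> j < r \<Longrightarrow> k < r \<Longrightarrow> F (i, j, k) \<in> {0..1}"
    and \<alpha>: "step_mean a b c r F = \<alpha>" "\<alpha> \<le> 1"
  shows "threshold_density finite_abelian_groups \<alpha> \<le> step_corner a b c r F"
proof (rule ccontr)
  define M where "M = threshold_density finite_abelian_groups \<alpha>"
  define T where "T = step_corner a b c r F"
  define \<eta> where "\<eta> = (M - T) / 6"
  assume "\<not> ?thesis"
  then have \<eta>: "\<eta> > 0" by (simp add: \<eta>_def M_def T_def)
  have "popular_corners finite_abelian_groups \<alpha> M"
    unfolding M_def by (rule threshold_density_greatest(2))
  then obtain N0 where N0: "\<And>G A. \<lbrakk>G \<in> finite_abelian_groups; order G \<ge> N0;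
      A \<subseteq> carrier G \<times> carrier G; pair_density G A \<ge> \<alpha>\<rbrakk> \<Longrightarrow>
      \<exists>d\<in>carrier G - {\<one>\<^bsub>G\<^esub>}. real (card (corner_base_points G A d)) > (M - \<eta>) * (real (order G))\<^sup>2"
    unfolding popular_corners_def using \<eta> by meson
  define \<kappa> where "\<kappa> = 2 * \<eta>\<^sup>2 / 9"
  have "\<kappa> > 0" using \<eta> by (simp add: \<kappa>_def)
  then have "(\<lambda>n::nat. (real n)^3 * (2 * exp (- \<kappa> * real n))) \<longlonglongrightarrow> 0" by real_asymp
  then have "eventually (\<lambda>n. (real n)^3 * (2 * exp (- \<kappa> * real n)) < 1) sequentially"
    by (rule order_tendstoD) simp
  moreover have "eventually (\<lambda>n. 3 < \<eta> * (real n)\<^sup>2) sequentially"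
    using \<eta> by real_asymp
  moreover have "eventually (\<lambda>n. n \<ge> max N0 1) sequentially" by (rule eventually_ge_at_top)
  ultimately have "eventually (\<lambda>n. (real n)^3 * (2 * exp (- \<kappa> * real n)) < 1 \<and>
      3 < \<eta> * (real n)\<^sup>2 \<and> n \<ge> max N0 1) sequentially"
    by (intro eventually_conj)
  then obtain n where n: "(real n)^3 * (2 * exp (- \<kappa> * real n)) < 1" "3 < \<eta> * (real n)\<^sup>2"
      "n \<ge> N0" "n > 0"
    by (auto simp: eventually_sequentially)
  obtain G where G: "G \<in> finite_abelian_groups" "order G = n"
    using finite_abelian_group_of_order[OF n(4)] .
  interpret corner_model G a b c r F
    using G(1) F by (simp add: corner_model_def corner_model_axioms_def finite_abelian_groups_def)
  obtain A where A: "A \<subseteq> carrier G \<times> carrier G" "real (card A) > (\<alpha> - \<eta>) * (real n)\<^sup>2"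
    "\<And>d. d \<in> carrier G - {\<one>\<^bsub>G\<^esub>} \<Longrightarrow> real (card (corner_base_points G A d)) < (T + \<eta>) * (real n)\<^sup>2"
    using exists_set_with_typical_counts[OF \<eta>] n(1) unfolding G(2) \<alpha>(1) T_def \<kappa>_def by metis
  obtain A' where A': "A \<subseteq> A'" "A' \<subseteq> carrier G \<times> carrier G" "pair_density G A' \<ge> \<alpha>"
    "real (card (A' - A)) \<le> \<eta> * (real n)\<^sup>2 + 1"
    using enlarge_to_density[OF finite_carrier _ A(1), of \<alpha> \<eta>] A(2) \<alpha>(2) \<eta> n(4) unfolding G(2)
    by (metis order_less_imp_le)
  obtain d where d: "d \<in> carrier G - {\<one>\<^bsub>G\<^esub>}"
      "real (card (corner_base_points G A' d)) > (M - \<eta>) * (real n)\<^sup>2"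
    using N0[OF G(1) _ A'(2,3)] n(3) unfolding G(2) by blast
  have "real (card (corner_base_points G A' d)) \<le>
      real (card (corner_base_points G A d)) + 3 * real (card (A' - A))"
    using card_corner_base_points_enlarge[OF finite_carrier _ A'(1,2), of d] d(1) by simp
  also have "\<dots> \<le> (T + \<eta>) * (real n)\<^sup>2 + 3 * (\<eta> * (real n)\<^sup>2 + 1)"
    using A(3)[OF d(1)] A'(4) by simp
  also have "\<dots> \<le> (T + 5 * \<eta>) * (real n)\<^sup>2"
    using n(2) by (simp add: algebra_simps)
  also have "T + 5 * \<eta> = M - \<eta>" by (simp add: \<eta>_def field_simps)
  finally show False using d(2) by simp
qed

lemma threshold_density_le_corner_functional:
  assumes f: "piecewise_constant f" and \<alpha>: "cube_integral f = \<alpha>" "\<alpha> \<le> 1"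
  shows "threshold_density finite_abelian_groups \<alpha> \<le> corner_functional f"
proof -
  obtain r xs ys zs where
    grid: "\<And>p. p \<in> {xs, ys, zs} \<Longrightarrow> p 0 = 0 \<and> p r = (1::real) \<and> (\<forall>i<r. p i \<le> p (Suc i))"
    and const: "\<And>i j k. i < r \<Longrightarrow> j < r \<Longrightarrow> k < r \<Longrightarrow>
      f constant_on ({xs i..<xs (Suc i)} \<times> {ys j..<ys (Suc j)} \<times> {zs k..<zs (Suc k)})"
    and range: "f \<in> {0..1} \<times> {0..1} \<times> {0..1} \<rightarrow> {0..1}"
    using f unfolding piecewise_constant_def by metis
  define F where "F = (\<lambda>(i, j, k). f (xs i, ys j, zs k))"
  have f_eq: "f (x, y, z) = F (i, j, k)"
    if cell: "i < r" "j < r" "k < r" "x \<in> {xs i..<xs (Suc i)}" "y \<in> {ys j..<ys (Suc j)}" "z \<in> {zs k..<zs (Suc k)}"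
    for i j k x y z
  proof -
    obtain v where v: "\<And>p. p \<in> {xs i..<xs (Suc i)} \<times> {ys j..<ys (Suc j)} \<times> {zs k..<zs (Suc k)} \<Longrightarrow> f p = v"
      using const[OF cell(1-3)] by (auto simp: constant_on_def)
    have "f (x, y, z) = v" by (rule v) (use cell in auto)
    moreover have "f (xs i, ys j, zs k) = v" by (rule v) (use cell in auto)
    ultimately show ?thesis by (simp add: F_def)
  qed
  have px: "\<And>i. i < r \<Longrightarrow> xs i \<le> xs (Suc i)" "xs 0 = 0" "xs r = 1" using grid[of xs] by auto
  have py: "\<And>i. i < r \<Longrightarrow> ys i \<le> ys (Suc i)" "ys 0 = 0" "ys r = 1" using grid[of ys] by auto
  have pz: "\<And>i. i < r \<Longrightarrow> zs i \<le> zs (Suc i)" "zs 0 = 0" "zs r = 1" using grid[of zs] by auto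
  have F01: "F (i, j, k) \<in> {0..1}" if "i < r" "j < r" "k < r" for i j k
  proof -
    have "xs i \<in> {0..1}" "ys j \<in> {0..1}" "zs k \<in> {0..1}"
      using grid_points_in_unit_interval[OF px(2,3,1) that(1)]
        grid_points_in_unit_interval[OF py(2,3,1) that(2)]
        grid_points_in_unit_interval[OF pz(2,3,1) that(3)] by simp_all
    then show ?thesis using range by (auto simp: F_def Pi_def)
  qed
  obtain a where a: "\<And>i. i < r \<Longrightarrow> pmf a i = xs (Suc i) - xs i" using grid_lengths_pmf[of xs r] px by metis
  obtain b where b: "\<And>i. i < r \<Longrightarrow> pmf b i = ys (Suc i) - ys i" using grid_lengths_pmf[of ys r] py by metis
  obtain c where c: "\<And>i. i < r \<Longrightarrow> pmf c i = zs (Suc i) - zs i" using grid_lengths_pmf[of zs r] pz by metis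
  have "cube_integral f = (\<Sum>i<r. \<Sum>j<r. \<Sum>k<r.
      (xs (Suc i) - xs i) * (ys (Suc j) - ys j) * (zs (Suc k) - zs k) * F (i, j, k))"
    by (rule cube_integral_step[OF grid]) (simp_all only: f_eq)
  then have mean: "step_mean a b c r F = \<alpha>" using \<alpha>(1) by (simp add: step_mean_def a b c)
  have iz: "integral {0..1} (\<lambda>z'. f (x, y, z')) = (\<Sum>k<r. (zs (Suc k) - zs k) * F (i, j, k))"
    if "i < r" "j < r" "x \<in> {xs i..<xs (Suc i)}" "y \<in> {ys j..<ys (Suc j)}" for i j x y
    by (rule unit_step_integral) (use pz f_eq that in auto)
  have iy: "integral {0..1} (\<lambda>y'. f (x, y', z)) = (\<Sum>j<r. (ys (Suc j) - ys j) * F (i, j, k))"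
    if "i < r" "k < r" "x \<in> {xs i..<xs (Suc i)}" "z \<in> {zs k..<zs (Suc k)}" for i k x z
    by (rule unit_step_integral) (use py f_eq that in auto)
  have ix: "integral {0..1} (\<lambda>x'. f (x', y, z)) = (\<Sum>i<r. (xs (Suc i) - xs i) * F (i, j, k))"
    if "j < r" "k < r" "y \<in> {ys j..<ys (Suc j)}" "z \<in> {zs k..<zs (Suc k)}" for j k y z
    by (rule unit_step_integral) (use px f_eq that in auto)
  have "corner_functional f = (\<Sum>i<r. \<Sum>j<r. \<Sum>k<r.
      (xs (Suc i) - xs i) * (ys (Suc j) - ys j) * (zs (Suc k) - zs k) *
      ((\<Sum>k'<r. (zs (Suc k') - zs k') * F (i, j, k')) * (\<Sum>j'<r. (ys (Suc j') - ys j') * F (i, j', k)) *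
       (\<Sum>i'<r. (xs (Suc i') - xs i') * F (i', j, k))))"
    unfolding corner_functional_def
    by (rule cube_integral_step[OF grid]) (simp_all only: prod.case ix iy iz)
  also have "\<dots> = step_corner a b c r F" by (simp add: step_corner_def a b c)
  finally show ?thesis using threshold_density_le_step_corner[OF F01 mean \<alpha>(2)] by simp
qed

theorem theorem3:
  fixes \<alpha> :: real
  assumes "\<alpha> \<in> {0..1}"
  shows "threshold_density finite_abelian_groups \<alpha> \<le> corner_infimum \<alpha>"
  unfolding corner_infimum_def
proof (rule cInf_greatest)
  have "piecewise_constant (\<lambda>_. \<alpha>)"
    unfolding piecewise_constant_def using assms
    by (auto simp: constant_on_def intro!: exI[of _ "1::nat"] exI[of _ real])
  moreover have "cube_integral (\<lambda>_. \<alpha>) = \<alpha>" by (simp add: cube_integral_def)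
  ultimately show "{corner_functional f |f. piecewise_constant f \<and> cube_integral f = \<alpha>} \<noteq> {}" by blast
next
  fix v assume "v \<in> {corner_functional f |f. piecewise_constant f \<and> cube_integral f = \<alpha>}"
  then show "threshold_density finite_abelian_groups \<alpha> \<le> v"
    using threshold_density_le_corner_functional assms by auto
qed

end
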